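(* For every integer $k \ge 3$, the digraph $H_k$ has no $k$-kernel.
   Context: Definition of $H_k$ (for an integer $k\ge 3$): let $V_k=\{v_1,\dots,v_{k-1}\}$, $U_k=\{u_1,\dots,u_{k-1}\}$, $W_k=\{w_1,\dots,w_{k-1}\}$ be pairwise disjoint sets with $k-1$ elements each, and let $E=\{e_v,f_v,e_u,f_u,e_w,f_w\}$ be a set of six elements disjoint from $V_k$, $U_k$ and $W_k$. The vertex set of $H_k$ is $V_k\cup U_k\cup W_k\cup E$, and its arcs are exactly: $(v_i,v_{i+1})$, $(u_i,u_{i+1})$, $(w_i,w_{i+1})$ for $1\le i\le k-2$; $(v_i,v_{i-1})$, $(u_i,u_{i-1})$, $(w_i,w_{i-1})$ for $2\le i\le k-1$; $(v_{k-1},u_1)$, $(u_{k-1},w_1)$, $(w_{k-1},v_1)$; and $(s_{k-1},e_s)$ and $(e_s,f_s)$ for each $s\in\{v,u,w\}$. In a digraph $D$, $d_D(u,v)$ is the length of a shortest directed path from $u$ to $v$ ($\infty$ if none exists). A set $S \subseteq V(D)$ is $k$-independent if $d_D(u,v)\ge k$ for every two distinct $u,v\in S$ (in both directions), and $\ell$-absorbent if for every $u \in V(D)\setminus S$ there is $v\in S$ with $d_D(u,v)\le \ell$. A $k$-kernel is a $k$-independent and $(k-1)$-absorbent set. *)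

theory Defs
  imports "Graph_Theory.Pair_Digraph" "Graph_Theory.Shortest_Path" "HOL-Library.Extended_Nat"
begin

text \<open>
  The length of a path is its number of arcs. The infimum in \<^typ>\<open>enat\<close> is a minimum if there is
  a path and \<open>\<infinity>\<close> otherwise.
\<close>

definition ddist :: "('a, 'b) pre_digraph \<Rightarrow> 'a \<Rightarrow> 'a \<Rightarrow> enat" where
  "ddist G u v = (INF p \<in> {p. pre_digraph.apath G u p v}. enat (length p))"

definition k_independent :: "nat \<Rightarrow> ('a, 'b) pre_digraph \<Rightarrow> 'a set \<Rightarrow> bool" where
  "k_independent k G S \<longleftrightarrow>
     S \<subseteq> verts G \<and> (\<forall>u\<in>S. \<forall>v\<in>S. u \<noteq> v \<longrightarrow> enat k \<le> ddist G u v)"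

definition l_absorbent :: "nat \<Rightarrow> ('a, 'b) pre_digraph \<Rightarrow> 'a set \<Rightarrow> bool" where
  "l_absorbent l G S \<longleftrightarrow>
     S \<subseteq> verts G \<and> (\<forall>u \<in> verts G - S. \<exists>v\<in>S. ddist G u v \<le> enat l)"

definition k_kernel :: "nat \<Rightarrow> ('a, 'b) pre_digraph \<Rightarrow> 'a set \<Rightarrow> bool" where
  "k_kernel k G S \<longleftrightarrow> k_independent k G S \<and> l_absorbent (k - 1) G S"

text \<open>
  \<open>Node s i\<close> is the vertex \<open>s\<^sub>i\<close>, \<open>E s\<close> is \<open>e\<^sub>s\<close> and \<open>F s\<close> is \<open>f\<^sub>s\<close>, for \<open>s\<close> one of the letters
  \<open>v\<close>, \<open>u\<close>, \<open>w\<close>; \<open>succ_letter\<close> is the cyclic order in which the three segments are joined.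
\<close>

datatype letter = LV | LU | LW

datatype hvertex = Node letter nat | E letter | F letter

fun succ_letter :: "letter \<Rightarrow> letter" where
  "succ_letter LV = LU"
| "succ_letter LU = LW"
| "succ_letter LW = LV"

definition H :: "nat \<Rightarrow> hvertex pair_pre_digraph" where
  "H k = \<lparr>
     pverts = {Node s i | s i. 1 \<le> i \<and> i \<le> k - 1} \<union> range E \<union> range F,
     parcs =
       {(Node s i, Node s (i + 1)) | s i. 1 \<le> i \<and> i \<le> k - 2}
       \<union> {(Node s i, Node s (i - 1)) | s i. 2 \<le> i \<and> i \<le> k - 1}
       \<union> {(Node s (k - 1), Node (succ_letter s) 1) | s. True}
       \<union> {(Node s (k - 1), E s) | s. True}
       \<union> {(E s, F s) | s. True} \<rparr>"

lemma ddist_eq_shortest_path: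
  assumes "wf_digraph G"
  shows "ereal_of_enat (ddist G u v) = wf_digraph.\<mu> G (\<lambda>_. 1) u v"
proof -
  interpret wf_digraph G by fact
  have cost: "awalk_cost (\<lambda>_. 1) p = real (length p)" for p :: "'b list"
    by (induction p) auto
  have shorten: "\<exists>q. apath u q v \<and> length q \<le> length p" if p: "awalk u p v" for p
  proof -
    have "awalk_cost (\<lambda>_. 1) (awalk_to_apath p) \<le> awalk_cost (\<lambda>_. 1) p"
      by (rule awalk_to_path_no_neg_cyc_cost[OF p]) (simp add: cost)
    with apath_awalk_to_apath[OF p] show ?thesis by (auto simp: cost)
  qed
  show ?thesis
  proof (cases "\<exists>p. apath u p v")
    case False
    then have "{p. apath u p v} = {}" "{p. awalk u p v} = {}" using shorten by auto
    then show ?thesis by (simp add: ddist_def \<mu>_def top_enat_def top_ereal_def)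
  next
    case True
    then have "ddist G u v \<in> (\<lambda>p. enat (length p)) ` {p. apath u p v}"
      unfolding ddist_def by (auto intro!: wellorder_InfI)
    then obtain p where p: "apath u p v" and d: "ddist G u v = enat (length p)" by auto
    have le: "length p \<le> length q" if q: "awalk u q v" for q
    proof -
      obtain r where r: "apath u r v" "length r \<le> length q" using shorten[OF q] by auto
      then have "ddist G u v \<le> enat (length r)" unfolding ddist_def by (auto intro: INF_lower)
      with r d show ?thesis by simp
    qed
    have "\<mu> (\<lambda>_. 1) u v = ereal (real (length p))"
      unfolding \<mu>_def cost
    proof (rule antisym)
      show "(INF p\<in>{p. awalk u p v}. ereal (real (length p))) \<le> ereal (real (length p))"
        using awalkI_apath[OF p] by (auto intro: INF_lower)
      show "ereal (real (length p)) \<le> (INF p\<in>{p. awalk u p v}. ereal (real (length p)))"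
        by (rule INF_greatest) (auto dest: le)
    qed
    with d show ?thesis by simp
  qed
qed

lemma H_pair_digraph:
  assumes "k \<ge> 3"
  shows "pair_digraph (H k)"
proof -
  have "finite (UNIV :: letter set)"
  proof (rule finite_subset)
    show "(UNIV :: letter set) \<subseteq> {LV, LU, LW}" using letter.exhaust by auto
  qed simp
  then have "finite (case_prod Node ` (UNIV \<times> {..k - 1}) \<union> range E \<union> range F)" by simp
  moreover have "pverts (H k) \<subseteq> case_prod Node ` (UNIV \<times> {..k - 1}) \<union> range E \<union> range F"
    by (auto simp: H_def)
  ultimately have fin: "finite (pverts (H k))" by (rule rev_finite_subset)
  have sub: "parcs (H k) \<subseteq> pverts (H k) \<times> pverts (H k)"
    using assms by (auto simp: H_def)
  show ?thesis
  proof
    show "finite (parcs (H k))" using finite_subset[OF sub] fin by simp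
    show "fst e \<noteq> snd e" if "e \<in> parcs (H k)" for e
    proof -
      have "s \<noteq> succ_letter s" for s by (cases s) auto
      then show ?thesis using that by (auto simp: H_def)
    qed
  qed (use fin sub in auto)
qed

end

theory Submission
  imports Defs
begin

text \<open>
  A \<open>k\<close>-kernel \<open>S\<close> of \<open>H\<^sub>k\<close> would have to be spread along a cycle of odd length by strict
  alternation. No arc leaves \<open>f\<^sub>s\<close>, so no other vertex can absorb it and it lies in \<open>S\<close>. The path
  \<open>s\<^sub>2, \<dots>, s\<^sub>k\<^sub>-\<^sub>1, e\<^sub>s, f\<^sub>s\<close> has \<open>k - 1\<close> arcs, so \<open>k\<close>-independence removes all its vertices except
  \<open>f\<^sub>s\<close> from \<open>S\<close>; only \<open>s\<^sub>1\<close>, at distance exactly \<open>k\<close> from \<open>f\<^sub>s\<close>, is still undecided.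
  The first vertices of the three segments are arranged cyclically, with distance \<open>k - 1\<close> from each
  to the next. Hence, with \<open>t\<close> the letter after \<open>s\<close>, if \<open>s\<^sub>1\<close> is in \<open>S\<close> then \<open>t\<^sub>1\<close> is not,
  by independence; and if \<open>s\<^sub>1\<close> is not in \<open>S\<close> then \<open>t\<^sub>1\<close> is, because no other candidate is within
  distance \<open>k - 1\<close> of \<open>s\<^sub>1\<close>. Membership therefore alternates around a cycle of length three,
  which is impossible.

  Upper bounds on distances come from following arcs (\<open>ddist_arc_le\<close>). Lower bounds come from
  potentials that grow by at most one along each arc (\<open>potential_le_ddist\<close>), so that no path has to
  be analysed.
\<close>

section \<open>Bounding distances in a digraph\<close>

lemma (in wf_digraph) ddist_le_awalk_length:
  assumes "awalk u p v"
  shows "ddist G u v \<le> enat (length p)"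
proof -
  have cost: "awalk_cost (\<lambda>_. 1) q = real (length q)" for q :: "'b list"
    by (induction q) auto
  have "\<mu> (\<lambda>_. 1) u v \<le> ereal (real (length p))"
    using min_cost_le_walk_cost[OF assms, of "\<lambda>_. 1"] by (simp add: cost)
  then have "ereal_of_enat (ddist G u v) \<le> ereal_of_enat (enat (length p))"
    by (simp add: ddist_eq_shortest_path[OF wf_digraph_axioms])
  then show ?thesis by (simp only: ereal_of_enat_le_iff)
qed

lemma (in wf_digraph) ddist_self:
  assumes "u \<in> verts G"
  shows "ddist G u u \<le> enat 0"
  using ddist_le_awalk_length[of u "[]" u] assms by (simp add: awalk_Nil_iff)

lemma (in wf_digraph) ddist_arc_le:
  assumes "a \<in> arcs G" and "ddist G (head G a) w \<le> enat n"
  shows "ddist G (tail G a) w \<le> enat (Suc n)"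
proof -
  have "{p. apath (head G a) p w} \<noteq> {}"
  proof
    assume "{p. apath (head G a) p w} = {}"
    then have "ddist G (head G a) w = \<infinity>" by (simp only: ddist_def) (simp add: top_enat_def)
    with assms(2) show False by simp
  qed
  then have "ddist G (head G a) w \<in> (\<lambda>p. enat (length p)) ` {p. apath (head G a) p w}"
    unfolding ddist_def by (auto intro!: wellorder_InfI)
  then obtain p where p: "apath (head G a) p w" and "ddist G (head G a) w = enat (length p)"
    by auto
  with assms(2) have "length p \<le> n" by simp
  moreover have "awalk (tail G a) (a # p) w"
    using awalkI_apath[OF p] assms(1) by (simp add: awalk_Cons_iff)
  ultimately show ?thesis
    using ddist_le_awalk_length[of "tail G a" "a # p" w] by (auto elim: order_trans)
qed

text \<open>
  A path must have at least as many arcs as the potential rises between its ends. This also gives a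
  bound for unreachable pairs, whose distance is infinite.
\<close>

lemma (in wf_digraph) potential_le_ddist:
  fixes g :: "'a \<Rightarrow> nat"
  assumes step: "\<And>a. a \<in> arcs G \<Longrightarrow> g (head G a) \<le> Suc (g (tail G a))"
  shows "enat (g v) \<le> enat (g u) + ddist G u v"
proof -
  have walk: "g v \<le> g u + length p" if "awalk u p v" for p
    using that
  proof (induction p arbitrary: u)
    case Nil
    then show ?case by (simp add: awalk_Nil_iff)
  next
    case (Cons a p)
    then have "a \<in> arcs G" "tail G a = u" "awalk (head G a) p v"
      by (auto simp: awalk_Cons_iff)
    with Cons.IH step[of a] show ?case by fastforce
  qed
  have "enat (g v - g u) \<le> ddist G u v"
    unfolding ddist_def by (rule INF_greatest) (auto dest!: awalkI_apath walk)
  then show ?thesis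
    by (cases "ddist G u v") auto
qed

section \<open>Distances in \<open>H\<^sub>k\<close>\<close>

lemma wf_digraph_H:
  assumes "k \<ge> 3"
  shows "wf_digraph (with_proj (H k))"
proof -
  interpret pair_digraph "H k" using assms by (rule H_pair_digraph)
  show ?thesis by unfold_locales
qed

lemma ddist_H_arc_le:
  assumes "k \<ge> 3" and "(x, y) \<in> parcs (H k)" and "ddist (with_proj (H k)) y z \<le> enat n"
  shows "ddist (with_proj (H k)) x z \<le> enat (Suc n)"
  using wf_digraph.ddist_arc_le[OF wf_digraph_H[OF assms(1)], of "(x, y)"] assms by simp

lemma ddist_H_self:
  assumes "k \<ge> 3" and "x \<in> pverts (H k)"
  shows "ddist (with_proj (H k)) x x \<le> enat 0"
  using wf_digraph.ddist_self[OF wf_digraph_H[OF assms(1)]] assms by simp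

lemma ddist_along_segment:
  assumes "k \<ge> 3" and "1 \<le> i" and "i \<le> k - 1"
    and "ddist (with_proj (H k)) (Node s (k - 1)) x \<le> enat n"
  shows "ddist (with_proj (H k)) (Node s i) x \<le> enat (k - 1 - i + n)"
  using assms(3,2)
proof (induction i rule: inc_induct)
  case base
  then show ?case using assms(4) by simp
next
  case (step i)
  have "(Node s i, Node s (Suc i)) \<in> parcs (H k)"
    using step by (auto simp: H_def)
  then have "ddist (with_proj (H k)) (Node s i) x \<le> enat (Suc (k - 1 - Suc i + n))"
    using ddist_H_arc_le[OF assms(1)] step by simp
  moreover have "Suc (k - 1 - Suc i + n) = k - 1 - i + n" using step by simp
  ultimately show ?case by (simp only:)
qed

lemma ddist_E_F:
  assumes "k \<ge> 3"
  shows "ddist (with_proj (H k)) (E s) (F s) \<le> enat 1"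
proof -
  have "(E s, F s) \<in> parcs (H k)" "F s \<in> pverts (H k)" by (auto simp: H_def)
  with ddist_H_arc_le ddist_H_self assms show ?thesis by fastforce
qed

lemma ddist_Node_F:
  assumes "k \<ge> 3" and "1 \<le> i" and "i \<le> k - 1"
  shows "ddist (with_proj (H k)) (Node s i) (F s) \<le> enat (k + 1 - i)"
proof -
  have "(Node s (k - 1), E s) \<in> parcs (H k)" by (auto simp: H_def)
  from ddist_H_arc_le[OF assms(1) this ddist_E_F[OF assms(1)]]
  have "ddist (with_proj (H k)) (Node s (k - 1)) (F s) \<le> enat 2" by (simp add: numeral_2_eq_2)
  from ddist_along_segment[OF assms this]
  have "ddist (with_proj (H k)) (Node s i) (F s) \<le> enat (k - 1 - i + 2)" .
  moreover have "k - 1 - i + 2 = k + 1 - i" using assms by simp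
  ultimately show ?thesis by (simp only:)
qed

lemma ddist_Node_1_succ:
  assumes "k \<ge> 3"
  shows "ddist (with_proj (H k)) (Node s 1) (Node (succ_letter s) 1) \<le> enat (k - 1)"
proof -
  let ?t = "Node (succ_letter s) 1"
  have "(Node s (k - 1), ?t) \<in> parcs (H k)" "?t \<in> pverts (H k)"
    using assms by (auto simp: H_def)
  with ddist_H_arc_le ddist_H_self assms
  have "ddist (with_proj (H k)) (Node s (k - 1)) ?t \<le> enat 1" by fastforce
  from ddist_along_segment[OF assms _ _ this, of 1] assms show ?thesis
    by (simp add: numeral_2_eq_2 Suc_diff_Suc)
qed

text \<open>
  No arc leaves \<open>f\<^sub>s\<close>, so the potential that vanishes there and is constant elsewhere has no arc
  along which it rises.
\<close>

lemma F_is_sink: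
  assumes "k \<ge> 3" and "x \<noteq> F s"
  shows "enat k \<le> ddist (with_proj (H k)) (F s) x"
proof -
  define g where "g x = (if x = F s then 0 else k)" for x
  have "g (snd a) \<le> Suc (g (fst a))" if "a \<in> parcs (H k)" for a
    using that by (auto simp: H_def g_def)
  then have "enat (g x) \<le> enat (g (F s)) + ddist (with_proj (H k)) (F s) x"
    by (intro wf_digraph.potential_le_ddist[OF wf_digraph_H[OF assms(1)]]) simp
  then show ?thesis using assms(2) by (simp add: g_def zero_enat_def[symmetric])
qed

text \<open>
  The potential is one plus the distance from \<open>s\<^sub>1\<close>, cut off at \<open>k + 1\<close>: the value \<open>k\<close> is first
  reached on leaving the segment, at \<open>e\<^sub>s\<close> and at the first vertex of the next segment.
\<close>

lemma ddist_from_Node_1_ge: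
  assumes "k \<ge> 3" and "\<And>i. x \<noteq> Node s i" and "x \<noteq> E s" and "x \<noteq> Node (succ_letter s) 1"
  shows "enat k \<le> ddist (with_proj (H k)) (Node s 1) x"
proof -
  define g where "g x = (case x of
      Node t i \<Rightarrow> if t = s then i else if t = succ_letter s \<and> i = 1 then k else k + 1
    | E t \<Rightarrow> if t = s then k else k + 1
    | F t \<Rightarrow> k + 1)" for x
  have ne: "succ_letter s \<noteq> s" by (cases s) auto
  have "g (snd a) \<le> Suc (g (fst a))" if "a \<in> parcs (H k)" for a
    using that assms(1) ne by (auto simp: H_def g_def)
  then have "enat (g x) \<le> enat (g (Node s 1)) + ddist (with_proj (H k)) (Node s 1) x"
    by (intro wf_digraph.potential_le_ddist[OF wf_digraph_H[OF assms(1)]]) simp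
  moreover have "g x = k + 1" "g (Node s 1) = 1"
    using assms(2-) by (auto simp: g_def split: hvertex.split)
  ultimately show ?thesis
    by (cases "ddist (with_proj (H k)) (Node s 1) x") auto
qed

section \<open>The shape of a \<open>k\<close>-kernel\<close>

lemma k_kernel_independentD:
  assumes "k_kernel k G S" and "x \<in> S" and "y \<in> S" and "x \<noteq> y" and "k > 0"
  shows "\<not> ddist G x y \<le> enat (k - 1)"
proof -
  have "enat k \<le> ddist G x y"
    using assms by (auto simp: k_kernel_def k_independent_def)
  moreover have "enat (k - 1) < enat k" using assms(5) by simp
  ultimately show ?thesis by (meson leD less_le_trans)
qed

lemma k_kernel_absorbentE:
  assumes "k_kernel k G S" and "x \<in> verts G" and "x \<notin> S" and "k > 0"
  obtains y where "y \<in> S" and "\<not> enat k \<le> ddist G x y"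
proof -
  obtain y where "y \<in> S" "ddist G x y \<le> enat (k - 1)"
    using assms by (auto simp: k_kernel_def l_absorbent_def)
  moreover have "enat (k - 1) < enat k" using assms(4) by simp
  ultimately show ?thesis using that by (meson leD le_less_trans)
qed

lemma F_in_k_kernel:
  assumes "k \<ge> 3" and "k_kernel k (with_proj (H k)) S"
  shows "F s \<in> S"
proof (rule ccontr)
  assume notin: "F s \<notin> S"
  have "F s \<in> verts (with_proj (H k))" by (auto simp: H_def)
  then obtain y where "y \<in> S" "\<not> enat k \<le> ddist (with_proj (H k)) (F s) y"
    using k_kernel_absorbentE[OF assms(2) _ notin] assms(1) by auto
  with F_is_sink[OF assms(1)] notin show False by metis
qed

lemma E_notin_k_kernel:
  assumes "k \<ge> 3" and "k_kernel k (with_proj (H k)) S"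
  shows "E s \<notin> S"
proof
  assume "E s \<in> S"
  from k_kernel_independentD[OF assms(2) this F_in_k_kernel[OF assms]] assms(1)
  have "\<not> ddist (with_proj (H k)) (E s) (F s) \<le> enat (k - 1)" by simp
  moreover have "enat 1 \<le> enat (k - 1)" using assms(1) by simp
  ultimately show False using ddist_E_F[OF assms(1)] order_trans by blast
qed

lemma Node_in_k_kernel:
  assumes "k \<ge> 3" and "k_kernel k (with_proj (H k)) S" and "Node s i \<in> S"
  shows "i = 1"
proof (rule ccontr)
  assume "i \<noteq> 1"
  have "Node s i \<in> pverts (H k)"
    using assms(2,3) by (auto simp: k_kernel_def k_independent_def)
  then have i: "1 \<le> i" "i \<le> k - 1" by (auto simp: H_def)
  with \<open>i \<noteq> 1\<close> have "enat (k + 1 - i) \<le> enat (k - 1)" by simp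
  moreover from k_kernel_independentD[OF assms(2,3) F_in_k_kernel[OF assms(1,2)]] assms(1)
  have "\<not> ddist (with_proj (H k)) (Node s i) (F s) \<le> enat (k - 1)" by simp
  ultimately show False using ddist_Node_F[OF assms(1) i] order_trans by blast
qed

lemma k_kernel_alternates:
  assumes "k \<ge> 3" and "k_kernel k (with_proj (H k)) S"
  shows "Node (succ_letter s) 1 \<in> S \<longleftrightarrow> Node s 1 \<notin> S"
proof
  assume succ: "Node (succ_letter s) 1 \<in> S"
  have "succ_letter s \<noteq> s" by (cases s) auto
  then show "Node s 1 \<notin> S"
    using k_kernel_independentD[OF assms(2) _ succ, of "Node s 1"] ddist_Node_1_succ[OF assms(1)]
      assms(1) by auto
next
  assume notin: "Node s 1 \<notin> S"
  have "Node s 1 \<in> verts (with_proj (H k))" using assms(1) by (auto simp: H_def)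
  then obtain y where y: "y \<in> S" "\<not> enat k \<le> ddist (with_proj (H k)) (Node s 1) y"
    using k_kernel_absorbentE[OF assms(2) _ notin] assms(1) by auto
  have "y \<noteq> E s" using E_notin_k_kernel[OF assms] y(1) by auto
  moreover have "y \<noteq> Node s i" for i using Node_in_k_kernel[OF assms] y(1) notin by auto
  ultimately have "y = Node (succ_letter s) 1"
    using ddist_from_Node_1_ge[OF assms(1)] y(2) by blast
  with y(1) show "Node (succ_letter s) 1 \<in> S" by simp
qed

theorem proposition5:
  fixes k :: nat
  assumes "k \<ge> 3"
  shows "\<not> (\<exists>S. k_kernel k (with_proj (H k)) S)"
proof
  assume "\<exists>S. k_kernel k (with_proj (H k)) S"
  then obtain S where S: "k_kernel k (with_proj (H k)) S" by blast
  note alternate = k_kernel_alternates[OF assms S]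
  show False using alternate[of LV] alternate[of LU] alternate[of LW] by simp
qed

end
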